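(* Let $d,k\in\mathbb{N}$. If $X$ is an $\omega^{2d+1}$-large finite set with $\min X > \max\{4,k\}$ and $C$ is a $k$-coloring of an $X$-quasistrong finite binary tree $T$ (i.e. $C:T\to\{0,\dots,k-1\}$), then there exist an $\omega^d$-large $Y\subseteq X$ and a tree $S\subseteq T$ such that $S$ is both $Y$-quasistrong and $(C,Y)$-prehomogeneous.
   Context: Strings are finite binary strings; $\sigma\preceq\tau$ means $\sigma$ is an initial segment of $\tau$, $|\sigma|$ is the length, $\sigma\upharpoonright n$ the initial segment of length $n$, and $2^i$ also denotes the set of strings of length $i$. A tree is a set of strings closed under initial segments. For a finite set $X=\{x_0<\dots<x_n\}\subseteq\mathbb{N}$, a finite binary tree $T$ is $X$-quasistrong if (i) $T\cap 2^{x_i}\neq\emptyset$ for every $i\le n$, and (ii) for each $i<n$, every $\sigma\in T\cap 2^{x_i}$ has exactly two incompatible extensions in $T\cap 2^{x_{i+1}}$. Given such $X$ and a coloring $C$, a tree $T$ is $(C,X)$-prehomogeneous if there is a color $c$ such that for every $i<n$, every $\sigma\in T\cap 2^{x_i}$ and every $\tau\in T\cap 2^{x_{i+1}}$ with $\sigma\prec\tau$, there is $\zeta\in T$ with $\sigma\preceq\zeta\preceq\tau$ and $C(\zeta)=c$. Largeness: for finite sets, $X<Y$ means $X=\emptyset\ne Y$ or $\max X<\min Y$; a stack is a sequence $X_0<X_1<\dots<X_{n-1}$ of nonempty finite sets. $X$ is $\omega^0$-large iff nonempty; $X$ is $\omega$-large if $|X|>\min X$; $X$ is $\omega^d\cdot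 n$-large if it is the union of a stack of $n$ many $\omega^d$-large sets; $X$ is $\omega^{d+1}$-large if $X=\{\min X\}\cup X_1$ with $\min X_1>\min X$ and $X_1$ $\omega^d\cdot\min X$-large. *)

theory Defs
  imports Main "HOL-Library.Sublist"
begin

definition is_tree :: "bool list set \<Rightarrow> bool" where
  "is_tree T \<longleftrightarrow> (\<forall>\<tau>\<in>T. \<forall>\<sigma>. prefix \<sigma> \<tau> \<longrightarrow> \<sigma> \<in> T)"

definition consec :: "nat set \<Rightarrow> nat \<Rightarrow> nat \<Rightarrow> bool" where
  "consec X x x' \<longleftrightarrow> x \<in> X \<and> x' \<in> X \<and> x < x' \<and> (\<forall>z\<in>X. \<not> (x < z \<and> z < x'))"

definition quasistrong :: "nat set \<Rightarrow> bool list set \<Rightarrow> bool" where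
  "quasistrong X T \<longleftrightarrow>
     finite X \<and> X \<noteq> {} \<and> finite T \<and> is_tree T \<and>
     (\<forall>x\<in>X. \<exists>\<sigma>\<in>T. length \<sigma> = x) \<and>
     (\<forall>x x'. consec X x x' \<longrightarrow>
        (\<forall>\<sigma>\<in>T. length \<sigma> = x \<longrightarrow>
           card {\<tau>\<in>T. length \<tau> = x' \<and> prefix \<sigma> \<tau>} = 2))"

definition prehomogeneous :: "(bool list \<Rightarrow> nat) \<Rightarrow> nat set \<Rightarrow> bool list set \<Rightarrow> bool" where
  "prehomogeneous C X T \<longleftrightarrow>
     (\<exists>c. \<forall>x x'. consec X x x' \<longrightarrow>
        (\<forall>\<sigma>\<in>T. \<forall>\<tau>\<in>T. length \<sigma> = x \<longrightarrow> length \<tau> = x' \<longrightarrow> prefix \<sigma> \<tau> \<longrightarrow>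
           (\<exists>\<zeta>\<in>T. prefix \<sigma> \<zeta> \<and> prefix \<zeta> \<tau> \<and> C \<zeta> = c)))"

definition large_mult :: "(nat set \<Rightarrow> bool) \<Rightarrow> nat \<Rightarrow> nat set \<Rightarrow> bool" where
  "large_mult P n X \<longleftrightarrow>
     (\<exists>Xs. length Xs = n \<and>
        (\<forall>i<n. finite (Xs ! i) \<and> Xs ! i \<noteq> {} \<and> P (Xs ! i)) \<and>
        (\<forall>i. Suc i < n \<longrightarrow> Max (Xs ! i) < Min (Xs ! Suc i)) \<and>
        X = \<Union> (set Xs))"

primrec olarge :: "nat \<Rightarrow> nat set \<Rightarrow> bool" where
  "olarge 0 X \<longleftrightarrow> finite X \<and> X \<noteq> {}"
| "olarge (Suc d) X \<longleftrightarrow> finite X \<and> X \<noteq> {} \<and>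
     large_mult (olarge d) (Min X) (X - {Min X})"

end

theory Submission
  imports Defs
begin

text \<open>
  The induction on \<open>d\<close> proves a statement that is uniform over the tree: there is one increasing
  sequence of levels, starting at \<open>x = Min X\<close>, along which every \<open>\<sigma> \<in> T\<close> of length \<open>x\<close> spreads in
  some colour depending on \<open>\<sigma>\<close>. For the step, \<open>X\<close> contains threefold exponentially many (in
  \<open>x\<close>) blocks that are large enough for the induction hypothesis, which gives every node at the
  start of a block a colour. There are at most \<open>2\<^sup>x\<close> nodes \<open>\<sigma>\<close>, and a potential argument, which does not
  depend on the (huge) number of nodes at the start of the blocks, yields extensions of all \<open>\<sigma>\<close> and
  \<open>x + 1\<close> blocks such that each \<open>\<sigma>\<close> has a colour that can be reached in each of these blocks from
  all nodes that lie above the extension of \<open>\<sigma>\<close> and at the end of an earlier one. Gluing the solutions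
  in the last \<open>x\<close> of these blocks gives the sequence for \<open>d + 1\<close>.
\<close>

section \<open>Initial segments of finite sets, and numerical bounds\<close>

lemma initial_segment:
  fixes I :: "nat set"
  assumes "finite I" "n \<le> card I"
  shows "\<exists>S\<subseteq>I. card S = n \<and> (\<forall>s\<in>S. \<forall>i\<in>I - S. s < i)"
  using assms
proof (induction n arbitrary: I)
  case 0
  then show ?case by (intro exI[of _ "{}"]) auto
next
  case (Suc n)
  have ne: "I \<noteq> {}" using Suc.prems(2) by auto
  let ?x = "Min I"
  have x: "?x \<in> I" using Suc.prems ne by auto
  then have "finite (I - {?x})" "n \<le> card (I - {?x})"
    using Suc.prems by simp_all
  from Suc.IH[OF this] obtain S where
    S: "S \<subseteq> I - {?x}" "card S = n" "\<forall>s\<in>S. \<forall>i\<in>I - {?x} - S. s < i" by blast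
  have "finite S" using S(1) Suc.prems(1) by (meson finite_Diff finite_subset)
  moreover have "?x \<notin> S" using S(1) by blast
  ultimately have "card (insert ?x S) = Suc n" using S(2) by simp
  moreover have "\<forall>s\<in>insert ?x S. \<forall>i\<in>I - insert ?x S. s < i"
  proof (intro ballI)
    fix s i assume s: "s \<in> insert ?x S" and i: "i \<in> I - insert ?x S"
    have "?x \<le> i" using i Suc.prems(1) by simp
    moreover have "?x \<noteq> i" using i by blast
    ultimately have "?x < i" by simp
    then show "s < i" using s i S(3) by blast
  qed
  moreover have "insert ?x S \<subseteq> I" using S(1) x by blast
  ultimately show ?case by (intro exI conjI)
qed

text \<open>A number of blocks that yields a chain of length \<open>m\<close> while at most
  \<open>Q\<close> freed pairs are tolerated. For the step: \<open>Q + 1\<close> segments, each long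
  enough for a chain of length \<open>m\<close>, below a top part of \<open>Q + 1\<close>
  blocks.\<close>

primrec chain_bound :: "nat \<Rightarrow> nat \<Rightarrow> nat" where
  "chain_bound Q 0 = 1"
| "chain_bound Q (Suc m) = (Q + 1) * chain_bound Q m + (Q + 1)"

lemma chain_bound_pos: "0 < chain_bound Q m"
  by (induction m) auto

lemma chain_bound_less: "chain_bound Q m < (Q + 2) ^ Suc m"
proof (induction m)
  case (Suc m)
  \<comment> \<open>The inequality is strict because it is \<open>chain_bound Q m + 1\<close> that
    grows by a factor of at most \<open>Q + 2\<close>.\<close>
  have "chain_bound Q (Suc m) + 1 \<le> (Q + 2) * (chain_bound Q m + 1)" by simp
  also have "\<dots> \<le> (Q + 2) * (Q + 2) ^ Suc m" using Suc.IH by (intro mult_le_mono) simp_all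
  finally show ?case by simp
qed simp

text \<open>\<open>n\<close> is the number of pairs still in play. The factor
  \<open>live_bound m n\<close> is the number of blocks that must survive when one of
  \<open>Suc n\<close> pairs is given up.\<close>

primrec live_bound :: "nat \<Rightarrow> nat \<Rightarrow> nat" where
  "live_bound m 0 = chain_bound 0 m"
| "live_bound m (Suc n) = chain_bound (Suc n * live_bound m n) m"

lemma live_bound_pos: "0 < live_bound m n"
  by (cases n) (simp_all add: chain_bound_pos)

lemma square_le_power2: "4 \<le> x \<Longrightarrow> x * x \<le> (2::nat) ^ x"
proof (induction x rule: nat_induct_at_least)
  case (Suc n)
  have "Suc n * Suc n = n * n + (2 * n + 1)" by simp
  also have "2 * n + 1 \<le> 4 * n" using Suc by simp
  also have "4 * n \<le> n * n" using Suc by simp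
  finally show ?case using Suc by simp
qed simp

text \<open>\<open>n\<close> will be the number of pairs of a node of length \<open>x\<close> and a
  colour. Each recursion step amounts to raising to the power \<open>x + 3\<close>, so the exponent
  of 2 is exponential in \<open>n\<close>, which is itself at most exponential in \<open>x\<close>;
  this makes three levels.\<close>

lemma live_bound_le_tower:
  assumes x: "5 \<le> x" and n: "n \<le> x * 2 ^ x"
  shows "live_bound (Suc x) n \<le> 2 ^ 2 ^ 2 ^ (2 * x)"
proof -
  define D :: nat where "D = 2 ^ (2 * x)"
  have DD: "D = 2 ^ x * 2 ^ x" by (simp add: D_def mult_2 power_add)
  have sq: "x * x \<le> 2 ^ x" using square_le_power2 x by simp
  have x2: "x + 1 \<le> 2 ^ x" using less_exp[of x] by linarith
  have nD: "m + 2 \<le> D" if "m \<le> x * 2 ^ x" for m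
  proof -
    have "m + 2 \<le> x * 2 ^ x + 2 ^ x"
      using that x power_increasing[of 1 x "2::nat"] by simp
    also have "\<dots> = (x + 1) * 2 ^ x" by simp
    also have "\<dots> \<le> D" unfolding DD using x2 by (intro mult_le_mono) simp_all
    finally show ?thesis .
  qed
  \<comment> \<open>The extra factor \<open>D\<close> dominates \<open>Suc n + 2\<close>, which
    absorbs the coefficients of the recursion.\<close>
  have main: "D * live_bound (Suc x) n \<le> 2 ^ (4 * x * (x + 3) ^ n)"
    using n
  proof (induction n)
    case 0
    have "D * live_bound (Suc x) 0 \<le> D * 2 ^ (x + 2)"
      using less_imp_le[OF chain_bound_less[of 0 "Suc x"]]
      by (intro mult_le_mono order_refl) (simp add: numeral_2_eq_2)
    also have "\<dots> = 2 ^ (3 * x + 2)" by (simp add: D_def flip: power_add)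
    also have "\<dots> \<le> 2 ^ (4 * x)" using x by (intro power_increasing) simp_all
    finally show ?case by simp
  next
    case (Suc n)
    let ?H = "live_bound (Suc x) n"
    have "Suc n * ?H + 2 \<le> (Suc n + 2) * ?H"
      using live_bound_pos[of "Suc x" n] by simp
    also have "\<dots> \<le> D * ?H" using nD[OF Suc.prems] by (intro mult_le_mono) simp_all
    finally have *: "Suc n * ?H + 2 \<le> D * ?H" .
    have "D * live_bound (Suc x) (Suc n) \<le> D * (Suc n * ?H + 2) ^ Suc (Suc x)"
      using less_imp_le[OF chain_bound_less[of "Suc n * ?H" "Suc x"]]
      by (intro mult_le_mono order_refl) (simp only: live_bound.simps)
    also have "\<dots> \<le> D * (D * ?H) ^ Suc (Suc x)"
      using * by (intro mult_le_mono power_mono) simp_all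
    also have "\<dots> \<le> (D * ?H) * (D * ?H) ^ Suc (Suc x)"
      using live_bound_pos[of "Suc x" n] by (intro mult_le_mono) simp_all
    also have "\<dots> = (D * ?H) ^ (x + 3)" by (simp add: numeral_3_eq_3)
    also have "\<dots> \<le> (2 ^ (4 * x * (x + 3) ^ n)) ^ (x + 3)"
      using Suc by (intro power_mono) simp_all
    also have "\<dots> = 2 ^ (4 * x * (x + 3) ^ Suc n)"
      by (simp add: mult_ac flip: power_mult)
    finally show ?case .
  qed
  have x4: "4 * x \<le> 2 ^ x"
    using mult_le_mono1[of 4 x x] x sq by linarith
  \<comment> \<open>Equality holds at \<open>x = 5\<close>.\<close>
  have x3: "x + 3 \<le> 2 ^ (x - 2)"
  proof -
    obtain l where l: "x = l + 5" using x le_Suc_ex add.commute by metis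
    have "l + 8 \<le> 2 ^ l * 8" using less_exp[of l] by linarith
    then show ?thesis by (simp add: l power_add)
  qed
  have "live_bound (Suc x) n \<le> D * live_bound (Suc x) n" by (simp add: D_def)
  also note main
  also have "4 * x * (x + 3) ^ n \<le> 2 ^ x * (2 ^ (x - 2)) ^ n"
    using x4 x3 by (intro mult_le_mono power_mono) simp_all
  also have "\<dots> = 2 ^ (x + (x - 2) * n)" by (simp add: power_add flip: power_mult)
  also have "x + (x - 2) * n \<le> x * 2 ^ x + (x - 2) * (x * 2 ^ x)"
    using n by (intro add_mono mult_le_mono) simp_all
  also have "\<dots> = (x - 1) * (x * 2 ^ x)"
    using x by (auto simp: algebra_simps dest!: le_Suc_ex)
  also have "\<dots> \<le> x * (x * 2 ^ x)" by (intro mult_le_mono) simp_all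
  also have "\<dots> \<le> 2 ^ x * 2 ^ x" using sq by (simp flip: mult.assoc)
  also have "\<dots> = 2 ^ (2 * x)" using DD D_def by simp
  finally show ?thesis by simp
qed

section \<open>The abstract potential argument\<close>

text \<open>
  In the application a \<open>v\<close> is a choice of extensions of all nodes of the lowest level, a \<open>p\<close> is
  a pair of such a node and a colour, \<open>low i v\<close> says that \<open>v\<close> stays below block \<open>i\<close>, and
  \<open>free v p i\<close> says that the colour does not occur in block \<open>i\<close> above the chosen extension.
\<close>

locale freeness =
  fixes le :: "'v \<Rightarrow> 'v \<Rightarrow> bool"
    and low :: "nat \<Rightarrow> 'v \<Rightarrow> bool"
    and free :: "'v \<Rightarrow> 'p \<Rightarrow> nat \<Rightarrow> bool"
  assumes le_refl: "le v v"
    and le_trans: "le u v \<Longrightarrow> le v w \<Longrightarrow> le u w"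
    and low_mono: "low i v \<Longrightarrow> i \<le> j \<Longrightarrow> low j v"
    and free_mono: "free v p i \<Longrightarrow> le v w \<Longrightarrow> free w p i"
begin

text \<open>The bound \<open>Suc j\<close> lets \<open>w\<close> climb through block
  \<open>j\<close>: when solutions are glued, \<open>w\<close> picks a node at the end of block
  \<open>j\<close>, and from there block \<open>i\<close> must be reached in every colour of
  \<open>P\<close>.\<close>

definition chain :: "'p set \<Rightarrow> 'v \<Rightarrow> nat set \<Rightarrow> bool" where
  "chain P v L \<longleftrightarrow> (\<forall>i\<in>L. low i v \<and> (\<forall>p\<in>P. \<not> free v p i \<and>
     (\<forall>j\<in>L. \<forall>w. j < i \<longrightarrow> le v w \<longrightarrow> low (Suc j) w \<longrightarrow> \<not> free w p i)))"

text \<open>The case in which a pair is given up: \<open>p\<close> is lost in all blocks of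
  \<open>A\<close>, and the search continues inside \<open>A\<close> with the other pairs.\<close>

definition thin :: "'p set \<Rightarrow> nat \<Rightarrow> 'v \<Rightarrow> nat set \<Rightarrow> bool" where
  "thin P a v I \<longleftrightarrow> (\<exists>w. \<exists>p\<in>P. \<exists>A\<subseteq>I. le v w \<and> card A = a \<and> (\<forall>i\<in>A. low i w \<and> free w p i))"

lemma thin_mono: "thin P a v I \<Longrightarrow> le u v \<Longrightarrow> I \<subseteq> J \<Longrightarrow> thin P a u J"
  unfolding thin_def by (meson le_trans order_trans)

definition freed :: "'p set \<Rightarrow> nat set \<Rightarrow> 'v \<Rightarrow> ('p \<times> nat) set" where
  "freed P Z v = {(p, i). p \<in> P \<and> i \<in> Z \<and> free v p i}"

lemma finite_freed: "finite P \<Longrightarrow> finite Z \<Longrightarrow> finite (freed P Z v)"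
  by (rule finite_subset[of _ "P \<times> Z"]) (auto simp: freed_def)

lemma freed_mono: "le v w \<Longrightarrow> freed P Z v \<subseteq> freed P Z w"
  by (auto simp: freed_def intro: free_mono)

lemma freed_eq_Sigma: "freed P Z v = (SIGMA p:P. {i\<in>Z. free v p i})"
  by (auto simp: freed_def)

text \<open>Pigeonhole: if every pair were free in fewer than \<open>a\<close> blocks of
  \<open>Z\<close>, there would be at most \<open>card P * a\<close> freed pairs.\<close>

lemma thin_if_many_freed:
  assumes "finite P" "finite Z" "\<forall>i\<in>Z. low i v" "card P * a < card (freed P Z v)"
  shows "thin P a v Z"
proof -
  have "\<exists>p\<in>P. a \<le> card {i\<in>Z. free v p i}"
  proof (rule ccontr)
    assume "\<not> ?thesis"
    then have "(\<Sum>p\<in>P. card {i\<in>Z. free v p i}) \<le> (\<Sum>p\<in>P. a)"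
      by (intro sum_mono) (auto simp: not_le intro: less_imp_le)
    then show False using assms by (simp add: freed_eq_Sigma)
  qed
  then obtain p where p: "p \<in> P" "a \<le> card {i\<in>Z. free v p i}" by blast
  then obtain A where "A \<subseteq> {i\<in>Z. free v p i}" "card A = a"
    using obtain_subset_with_card_n by metis
  then show ?thesis using p assms(3) unfolding thin_def
    by (intro exI[of _ v] bexI[of _ p] exI[of _ A]) (auto simp: le_refl)
qed

text \<open>
  The potential is the number of free pairs in the top part \<open>Z\<close> of \<open>I\<close>. As long as it increases,
  move up to the next segment of the lower part. Once it is stable over a whole segment, the
  induction hypothesis in that segment supplies a chain, which continues to a block of \<open>Z\<close>.
\<close>

lemma thin_or_chain:
  assumes "finite P" "finite I" "chain_bound (card P * a) m \<le> card I" "\<forall>i\<in>I. low i v"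
  shows "thin P a v I \<or>
    (\<exists>w L. le v w \<and> L \<subseteq> I \<and> card L = m \<and> chain P w L \<and> (\<exists>i\<in>I. low i w))"
  using assms(2-)
proof (induction m arbitrary: v I)
  case 0
  then obtain i where "i \<in> I" by fastforce
  then show ?case using 0
    by (intro disjI2 exI[of _ v] exI[of _ "{}"]) (auto simp: le_refl chain_def)
next
  case (Suc m)
  note IH = Suc.IH
  define Q where "Q = card P * a"
  define h where "h = chain_bound Q m"
  have hI: "(Q + 1) * h + (Q + 1) \<le> card I" using Suc.prems(2) by (simp add: Q_def h_def)
  then obtain J where J: "J \<subseteq> I" "card J = card I - (Q + 1)" "\<forall>s\<in>J. \<forall>i\<in>I - J. s < i"
    using initial_segment[OF Suc.prems(1), of "card I - (Q + 1)"] by auto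
  define Z where "Z = I - J"
  have finJ: "finite J" using J(1) Suc.prems(1) finite_subset by blast
  have finZ: "finite Z" using Suc.prems(1) by (simp add: Z_def)
  have cZ: "card Z = Q + 1" using J hI finJ by (simp add: Z_def card_Diff_subset)
  have cJ: "(Q + 1) * h \<le> card J" using J hI by simp
  \<comment> \<open>\<open>q\<close> counts the segments of size \<open>h\<close> still available in
    \<open>J\<close>. Each move spends one of them and raises the potential, so at
    \<open>q = 0\<close> the potential exceeds \<open>Q\<close>.\<close>
  have "thin P a v I \<or>
      (\<exists>w L. le v w \<and> L \<subseteq> I \<and> card L = Suc m \<and> chain P w L \<and> (\<exists>i\<in>I. low i w))"
    if "finite J" "J \<subseteq> I" "\<forall>s\<in>J. \<forall>i\<in>Z. s < i" "q * h \<le> card J" "\<forall>i\<in>J \<union> Z. low i v"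
      "Q + 1 \<le> card (freed P Z v) + q" for q v J
    using that
  proof (induction q arbitrary: v J)
    case 0
    then show ?case
      using thin_if_many_freed[OF assms(1) finZ, of v a] thin_mono[of P a v Z v I]
      by (auto simp: Q_def le_refl Z_def)
  next
    case (Suc q)
    show ?case
    proof (cases "card P * a < card (freed P Z v)")
      case True
      then show ?thesis
        using thin_if_many_freed[OF assms(1) finZ, of v a] thin_mono[of P a v Z v I] Suc.prems
        by (auto simp: le_refl Z_def)
    next
      case few: False
      have "h \<le> card J" using Suc.prems(4) by simp
      then obtain S where S: "S \<subseteq> J" "card S = h" "\<forall>s\<in>S. \<forall>i\<in>J - S. s < i"
        using initial_segment[OF Suc.prems(1)] by blast
      have finS: "finite S" using S(1) Suc.prems(1) finite_subset by blast
      have neS: "S \<noteq> {}" using S(2) chain_bound_pos[of Q m] by (auto simp: h_def)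
      let ?j = "Max S"
      have j: "?j \<in> S" using finS neS by simp
      \<comment> \<open>If a move that stays below everything after \<open>S\<close> frees a new
        pair in \<open>Z\<close>, it is made and \<open>S\<close> is spent. Otherwise the freed
        pairs are the same for all such moves.\<close>
      show ?thesis
      proof (cases "\<exists>w. le v w \<and> low (Suc ?j) w \<and> \<not> freed P Z w \<subseteq> freed P Z v")
        case True
        then obtain w where w: "le v w" "low (Suc ?j) w" "\<not> freed P Z w \<subseteq> freed P Z v" by blast
        have "freed P Z v \<subset> freed P Z w"
          using freed_mono[OF w(1), of P Z] w(3) by blast
        then have less: "card (freed P Z v) < card (freed P Z w)"
          by (intro psubset_card_mono finite_freed assms(1) finZ)
        have "\<forall>i\<in>(J - S) \<union> Z. low i w"
        proof
          fix i assume "i \<in> (J - S) \<union> Z"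
          then have "?j < i" using j S Suc.prems(3) by blast
          then show "low i w" using w(2) low_mono by (meson Suc_leI)
        qed
        moreover have "finite (J - S)" "J - S \<subseteq> I" "\<forall>s\<in>J - S. \<forall>i\<in>Z. s < i"
          using Suc.prems(1-3) by auto
        moreover have "q * h \<le> card (J - S)"
          using Suc.prems(4) S finS by (simp add: card_Diff_subset)
        moreover have "Q + 1 \<le> card (freed P Z w) + q"
          using Suc.prems(6) less by linarith
        ultimately have "thin P a w I \<or>
            (\<exists>u L. le w u \<and> L \<subseteq> I \<and> card L = Suc m \<and> chain P u L \<and> (\<exists>i\<in>I. low i u))"
          using Suc.IH[of "J - S" w] by satx
        then show ?thesis using thin_mono[OF _ w(1) order_refl] le_trans[OF w(1)] by meson
      next
        case stable: False
        \<comment> \<open>At most \<open>Q\<close> pairs are freed and \<open>Z\<close> has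
          \<open>Q + 1\<close> blocks, so some block \<open>i\<close> of \<open>Z\<close> has no
          free pair. By stability this persists for all moves with
          \<open>low (Suc ?j)\<close>.\<close>
        have "card (snd ` freed P Z v) < card Z"
          using few cZ card_image_le[OF finite_freed[OF assms(1) finZ], of snd v]
          by (simp add: Q_def)
        then obtain i where i: "i \<in> Z" "i \<notin> snd ` freed P Z v"
          by (metis card_mono finite_freed assms(1) finZ finite_imageI linorder_not_less subsetI)
        have "thin P a v S \<or>
            (\<exists>w L. le v w \<and> L \<subseteq> S \<and> card L = m \<and> chain P w L \<and> (\<exists>i\<in>S. low i w))"
        proof (rule IH)
          show "finite S" by (fact finS)
          show "chain_bound (card P * a) m \<le> card S" using S(2) by (simp add: h_def Q_def)
          show "\<forall>i\<in>S. low i v" using S(1) Suc.prems(5) by blast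
        qed
        then consider "thin P a v S"
          | w L l where "le v w" "L \<subseteq> S" "card L = m" "chain P w L" "l \<in> S" "low l w"
          by blast
        then show ?thesis
        proof cases
          case 1
          then show ?thesis using thin_mono[OF 1 le_refl, of I] S(1) Suc.prems(2) by auto
        next
          case w: 2
          have notfree: "\<not> free u p i" if "le v u" "low (Suc ?j) u" "p \<in> P" for u p
            using stable that i by (force simp: freed_def)
          \<comment> \<open>An empty \<open>L\<close> gives no bound on \<open>w\<close>; the block
            \<open>l\<close>, the last clause of the induction hypothesis, does.\<close>
          have jw: "low (Suc ?j) w"
            using w(5,6) finS low_mono[of l w "Suc ?j"] by (simp add: le_SucI)
          have ij: "\<forall>s\<in>S. s < i" using S(1) Suc.prems(3) i(1) by blast
          have "low i w" using jw ij j low_mono by (meson Suc_leI)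
          moreover have "\<not> free u p i" if "l' \<in> L" "le w u" "low (Suc l') u" "p \<in> P" for u p l'
          proof -
            have "l' \<le> ?j" using that(1) w(2) finS by auto
            then show ?thesis
              by (intro notfree le_trans[OF w(1)] low_mono[of "Suc l'" u "Suc ?j"] that) simp
          qed
          moreover have "\<not> free w p i" if "p \<in> P" for p
            using notfree[OF w(1) jw that] .
          moreover have "\<not> i < l'" if "l' \<in> L" for l' using that ij w(2) by force
          ultimately have "chain P w (insert i L)"
            using w(4) unfolding chain_def by (metis insert_iff less_irrefl)
          moreover have "card (insert i L) = Suc m"
            using w(2,3) finite_subset[OF w(2) finS] ij by (metis card_insert_disjoint less_irrefl subsetD)
          moreover have "insert i L \<subseteq> I"
            using w(2) S(1) Suc.prems(2) i(1) unfolding Z_def by blast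
          moreover have "i \<in> I" using i(1) by (simp add: Z_def)
          ultimately show ?thesis
            using w(1) \<open>low i w\<close> by meson
        qed
      qed
    qed
  qed
  from this[OF finJ J(1) J(3)[folded Z_def] cJ] show ?case
    using Suc.prems(3) J(1) by (simp add: Z_def Un_absorb1)
qed

text \<open>Induction on the number of pairs. Either all pairs of \<open>P\<close> form a chain, or
  one pair becomes free in many blocks; it is then dropped and the search is repeated inside these
  blocks, where it remains free by \<open>free_mono\<close>. \<open>Q\<close> collects the pairs
  that are never dropped.\<close>

lemma live_chain:
  assumes "finite P" "finite I" "live_bound m (card P) \<le> card I" "\<forall>i\<in>I. low i v"
  shows "\<exists>w Q L. le v w \<and> Q \<subseteq> P \<and> L \<subseteq> I \<and> card L = m \<and> chain Q w L \<and>
    (\<forall>p\<in>P - Q. \<forall>i\<in>L. free w p i)"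
  using assms
proof (induction "card P" arbitrary: P I v)
  case 0
  then have "P = {}" by simp
  with thin_or_chain[of P I 0 m v] 0 show ?case by (simp add: thin_def) blast
next
  case (Suc n)
  define a where "a = live_bound m n"
  have "chain_bound (card P * a) m \<le> card I"
    using Suc.prems(3) Suc.hyps(2)[symmetric] by (simp add: a_def)
  from thin_or_chain[OF Suc.prems(1,2) this Suc.prems(4)]
  show ?case
  proof
    assume "thin P a v I"
    then obtain w p A where w: "p \<in> P" "A \<subseteq> I" "le v w" "card A = a"
      "\<forall>i\<in>A. low i w \<and> free w p i" unfolding thin_def by blast
    have c: "n = card (P - {p})" using w(1) Suc.hyps(2) Suc.prems(1) by simp
    have "finite (P - {p})" "finite A" "live_bound m (card (P - {p})) \<le> card A"
      using Suc.prems(1,2) w(2,4) finite_subset by (auto simp: a_def c)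
    from Suc.hyps(1)[OF c this] w(5) obtain u Q L where u: "le w u" "Q \<subseteq> P - {p}" "L \<subseteq> A"
      "card L = m" "chain Q u L" "\<forall>q\<in>P - {p} - Q. \<forall>i\<in>L. free u q i" by blast
    have "\<forall>q\<in>P - Q. \<forall>i\<in>L. free u q i"
    proof (intro ballI)
      fix q i assume q: "q \<in> P - Q" and i: "i \<in> L"
      show "free u q i"
      proof (cases "q = p")
        case True
        then show ?thesis using w(5) u(1,3) i free_mono by blast
      next
        case False
        then show ?thesis using u(6) q i by blast
      qed
    qed
    moreover have "le v u" using le_trans w(3) u(1) .
    moreover have "Q \<subseteq> P" "L \<subseteq> I" using u(2,3) w(2) by auto
    ultimately show ?thesis using u(4,5) by blast
  next
    assume "\<exists>w L. le v w \<and> L \<subseteq> I \<and> card L = m \<and> chain P w L \<and> (\<exists>i\<in>I. low i w)"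
    then show ?thesis by (metis Diff_cancel empty_iff order_refl)
  qed
qed

end

section \<open>Blocks and growth rates of large sets\<close>

text \<open>The blocks are merely contained in \<open>X\<close>, in contrast to
  \<open>large_mult\<close>, so that blocks of a block of \<open>X\<close> are again blocks of
  \<open>X\<close>.\<close>

definition blocks :: "nat \<Rightarrow> nat set \<Rightarrow> nat \<Rightarrow> (nat \<Rightarrow> nat set) \<Rightarrow> bool" where
  "blocks e X n B \<longleftrightarrow>
     (\<forall>i<n. finite (B i) \<and> B i \<noteq> {} \<and> B i \<subseteq> X \<and> Min X < Min (B i) \<and> olarge e (B i)) \<and>
     (\<forall>i. Suc i < n \<longrightarrow> Max (B i) < Min (B (Suc i)))"

lemma blocksD:
  assumes "blocks e X n B" "i < n"
  shows "finite (B i)" "B i \<noteq> {}" "B i \<subseteq> X" "Min X < Min (B i)" "olarge e (B i)"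
    "Min (B i) \<in> B i" "Max (B i) \<in> B i" "Min (B i) \<le> Max (B i)"
proof -
  show fin: "finite (B i)" and ne: "B i \<noteq> {}" and "B i \<subseteq> X" "Min X < Min (B i)" "olarge e (B i)"
    using assms unfolding blocks_def by blast+
  show "Min (B i) \<in> B i" "Max (B i) \<in> B i" "Min (B i) \<le> Max (B i)"
    using fin ne by simp_all
qed

lemma blocks_Suc: "blocks e X n B \<Longrightarrow> Suc i < n \<Longrightarrow> Max (B i) < Min (B (Suc i))"
  by (auto simp: blocks_def)

lemma blocks_less:
  assumes "blocks e X n B" "i < j" "j < n"
  shows "Max (B i) < Min (B j)"
  using assms(2,3)
proof (induction j)
  case (Suc j)
  have 1: "Max (B j) < Min (B (Suc j))" using blocks_Suc[OF assms(1) Suc.prems(2)] .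
  show ?case
  proof (cases "i = j")
    case True
    with 1 show ?thesis by simp
  next
    case False
    then have "Max (B i) < Min (B j)" using Suc by simp
    also have "\<dots> \<le> Max (B j)" using blocksD(8)[OF assms(1)] Suc.prems(2) by simp
    finally show ?thesis using 1 by simp
  qed
qed simp

lemma olarge_SucE:
  assumes "olarge (Suc e) X"
  obtains B where "blocks e X (Min X) B"
proof -
  from assms have X: "finite X" "X \<noteq> {}" by auto
  from assms have "large_mult (olarge e) (Min X) (X - {Min X})" by simp
  then obtain Xs where Xs: "length Xs = Min X"
    "\<forall>i<Min X. finite (Xs ! i) \<and> Xs ! i \<noteq> {} \<and> olarge e (Xs ! i)"
    "\<forall>i. Suc i < Min X \<longrightarrow> Max (Xs ! i) < Min (Xs ! Suc i)"
    "X - {Min X} = \<Union> (set Xs)" unfolding large_mult_def by (elim exE conjE)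
  have "Xs ! i \<subseteq> X \<and> Min X < Min (Xs ! i)" if "i < Min X" for i
  proof
    have "Xs ! i \<in> set Xs" using that Xs(1) by (intro nth_mem) simp
    then have sub: "Xs ! i \<subseteq> X - {Min X}" unfolding Xs(4) by (rule Union_upper)
    then show "Xs ! i \<subseteq> X" by blast
    have "Min (Xs ! i) \<in> Xs ! i" using that Xs(2) by simp
    then have "Min (Xs ! i) \<in> X" "Min (Xs ! i) \<noteq> Min X" using sub by auto
    then show "Min X < Min (Xs ! i)" using X by (simp add: order_le_neq_trans)
  qed
  then have "blocks e X (Min X) (\<lambda>i. Xs ! i)" using Xs(2,3) unfolding blocks_def by simp
  then show thesis by (rule that)
qed

text \<open>Above \<open>Min X\<close> there are \<open>Min X\<close> successive nonempty blocks,
  and each raises the maximum by at least one.\<close>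

lemma olarge_double:
  assumes "olarge (Suc e) X"
  shows "2 * Min X \<le> Max X"
proof (cases "Min X")
  case (Suc n)
  obtain B where B: "blocks e X (Min X) B" using olarge_SucE[OF assms] .
  have *: "Min X + 1 + i \<le> Min (B i)" if "i < Min X" for i
    using that
  proof (induction i)
    case 0
    then show ?case using blocksD(4)[OF B 0] by simp
  next
    case (Suc i)
    then show ?case using blocksD(8)[OF B, of i] blocks_Suc[OF B Suc.prems] by simp
  qed
  have n: "n < Min X" using Suc by simp
  have "2 * Min X \<le> Min (B n)" using *[OF n] Suc by simp
  also have "\<dots> \<le> Max X" using blocksD(3,6)[OF B n] assms by (auto intro!: Max_ge)
  finally show ?thesis .
qed simp

text \<open>Each of the \<open>Min X\<close> blocks doubles, by
  \<open>olarge_double\<close>.\<close>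

lemma olarge_exp:
  assumes "olarge (Suc (Suc e)) X" "0 < Min X"
  shows "2 ^ Min X \<le> Max X"
proof -
  obtain n where n: "Min X = Suc n" using assms(2) gr0_conv_Suc by blast
  obtain B where B: "blocks (Suc e) X (Min X) B" using olarge_SucE[OF assms(1)] .
  have *: "2 ^ Suc i \<le> Max (B i)" if "i < Min X" for i
    using that
  proof (induction i)
    case 0
    then show ?case using blocksD(4)[OF B 0] olarge_double[OF blocksD(5)[OF B 0]] by simp
  next
    case (Suc i)
    then show ?case
      using blocks_Suc[OF B Suc.prems] olarge_double[OF blocksD(5)[OF B Suc.prems]] by simp
  qed
  have "2 ^ Min X \<le> Max (B n)" using *[of n] n by simp
  also have "\<dots> \<le> Max X" using blocksD(3,7)[OF B, of n] n assms(1) by (auto intro!: Max_ge)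
  finally show ?thesis .
qed

text \<open>This is where two exponents are spent. The first four of the at least five blocks
  exponentiate once each: one exponential covers the passage from \<open>x\<close> to
  \<open>2 * x\<close>, three build the tower. The minimum of the fifth block is then so large that
  its own decomposition has enough parts.\<close>

lemma olarge_blocks:
  assumes "olarge (Suc (Suc (Suc e))) X" "5 \<le> Min X"
  obtains M B where "2 ^ 2 ^ 2 ^ (2 * Min X) \<le> M" "blocks (Suc e) X M B"
proof -
  let ?x = "Min X"
  obtain G where G: "blocks (Suc (Suc e)) X ?x G" using olarge_SucE[OF assms(1)] .
  have grow: "2 ^ Min (G i) \<le> Min (G (Suc i))" if "i < 4" for i
  proof -
    have i: "i < ?x" "Suc i < ?x" using that assms(2) by simp_all
    have "2 ^ Min (G i) \<le> Max (G i)"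
      using olarge_exp[OF blocksD(5)[OF G i(1)]] blocksD(4)[OF G i(1)] by linarith
    then show ?thesis using blocks_Suc[OF G i(2)] by linarith
  qed
  have x: "0 < ?x" "4 < ?x" using assms(2) by simp_all
  have "2 ^ (?x + 1) \<le> (2::nat) ^ Min (G 0)"
    using blocksD(4)[OF G x(1)] by (intro power_increasing) simp_all
  also have "\<dots> \<le> Min (G 1)" using grow[of 0] by simp
  finally have "2 * 2 ^ ?x \<le> Min (G 1)" by simp
  moreover have "?x < 2 ^ ?x" by (rule less_exp)
  ultimately have "2 * ?x \<le> Min (G 1)" by linarith
  then have "2 ^ (2 * ?x) \<le> (2::nat) ^ Min (G 1)" by (intro power_increasing) simp_all
  also have "\<dots> \<le> Min (G 2)" using grow[of 1] by (simp add: numeral_2_eq_2)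
  finally have "2 ^ 2 ^ (2 * ?x) \<le> (2::nat) ^ Min (G 2)" by (intro power_increasing) simp_all
  also have "\<dots> \<le> Min (G 3)" using grow[of 2] by (simp add: eval_nat_numeral)
  finally have "2 ^ 2 ^ 2 ^ (2 * ?x) \<le> (2::nat) ^ Min (G 3)" by (intro power_increasing) simp_all
  also have "\<dots> \<le> Min (G 4)" using grow[of 3] by (simp add: eval_nat_numeral)
  finally have big: "2 ^ 2 ^ 2 ^ (2 * ?x) \<le> Min (G 4)" .
  obtain B where B: "blocks (Suc e) (G 4) (Min (G 4)) B"
    using olarge_SucE[OF blocksD(5)[OF G x(2)]] .
  have "blocks (Suc e) X (Min (G 4)) B"
    using B blocksD(3,4)[OF G x(2)] unfolding blocks_def by (meson less_trans order_trans)
  then show thesis using big that by blast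
qed

section \<open>Splitting between arbitrary levels\<close>

text \<open>A weakening of \<open>quasistrong\<close> that passes to subsets of \<open>X\<close>,
  and hence to blocks: at least two extensions, between any two levels.\<close>

definition splits :: "nat set \<Rightarrow> bool list set \<Rightarrow> bool" where
  "splits X T \<longleftrightarrow> (\<forall>\<sigma>\<in>T. \<forall>x\<in>X. length \<sigma> \<in> X \<longrightarrow> length \<sigma> < x \<longrightarrow>
     (\<exists>\<tau>\<in>T. \<exists>\<rho>\<in>T. \<tau> \<noteq> \<rho> \<and> length \<tau> = x \<and> length \<rho> = x \<and> prefix \<sigma> \<tau> \<and> prefix \<sigma> \<rho>))"

lemma splits_subset: "splits X T \<Longrightarrow> Y \<subseteq> X \<Longrightarrow> splits Y T"
  unfolding splits_def by blast

lemma splits_extend: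
  assumes "splits X T" "\<sigma> \<in> T" "length \<sigma> \<in> X" "x \<in> X" "length \<sigma> \<le> x"
  obtains \<tau> where "\<tau> \<in> T" "prefix \<sigma> \<tau>" "length \<tau> = x"
proof (cases "length \<sigma> = x")
  case True
  then show ?thesis using assms(2) that by blast
next
  case False
  then have "length \<sigma> < x" using assms(5) by simp
  then show ?thesis using assms that unfolding splits_def by blast
qed

lemma quasistrong_splits:
  assumes "quasistrong X T"
  shows "splits X T"
proof -
  have fin: "finite X"
    and two: "\<And>x x' \<sigma>. consec X x x' \<Longrightarrow> \<sigma> \<in> T \<Longrightarrow> length \<sigma> = x \<Longrightarrow>
      card {\<tau>\<in>T. length \<tau> = x' \<and> prefix \<sigma> \<tau>} = 2"
    using assms by (auto simp: quasistrong_def)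
  have "\<exists>\<tau>\<in>T. \<exists>\<rho>\<in>T. \<tau> \<noteq> \<rho> \<and> length \<tau> = x \<and> length \<rho> = x \<and> prefix \<sigma> \<tau> \<and> prefix \<sigma> \<rho>"
    if "x \<in> X" "\<sigma> \<in> T" "length \<sigma> \<in> X" "length \<sigma> < x" for x \<sigma>
    using that(1,4)
  proof (induction x rule: less_induct)
    case (less x)
    \<comment> \<open>\<open>z\<close> is the predecessor of \<open>x\<close> in \<open>X\<close>;
      the set contains \<open>length \<sigma>\<close> and is therefore nonempty.\<close>
    define z where "z = Max {z\<in>X. z < x}"
    have ne: "finite {z\<in>X. z < x}" "length \<sigma> \<in> {z\<in>X. z < x}" using fin that less.prems by auto
    then have "z \<in> {z\<in>X. z < x}" unfolding z_def by (intro Max_in) blast+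
    then have z: "z \<in> X" "z < x" by simp_all
    have zmax: "y \<le> z" if "y \<in> X" "y < x" for y using that ne by (simp add: z_def)
    have c: "consec X z x"
      unfolding consec_def using z less.prems zmax by (auto simp: not_less)
    show ?case
    proof (cases "length \<sigma> = z")
      case True
      from two[OF c that(2) True] obtain \<tau> \<rho> where
        "{\<tau>\<in>T. length \<tau> = x \<and> prefix \<sigma> \<tau>} = {\<tau>, \<rho>}" "\<tau> \<noteq> \<rho>" unfolding card_2_iff by blast
      then show ?thesis by blast
    next
      case False
      then have "length \<sigma> < z" using zmax[OF that(3) less.prems(2)] by simp
      then obtain \<tau> \<rho> where tr: "\<tau> \<in> T" "\<rho> \<in> T" "\<tau> \<noteq> \<rho>" "length \<tau> = z" "length \<rho> = z"
        "prefix \<sigma> \<tau>" "prefix \<sigma> \<rho>" using less.IH[OF z(2,1)] by blast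
      have ext: "\<exists>\<beta>\<in>T. length \<beta> = x \<and> prefix \<alpha> \<beta>" if "\<alpha> \<in> T" "length \<alpha> = z" for \<alpha>
      proof -
        have "{\<beta>\<in>T. length \<beta> = x \<and> prefix \<alpha> \<beta>} \<noteq> {}"
          using two[OF c that] by (metis card.empty zero_neq_numeral)
        then show ?thesis by blast
      qed
      obtain \<tau>' \<rho>' where ex: "\<tau>' \<in> T" "length \<tau>' = x" "prefix \<tau> \<tau>'"
        "\<rho>' \<in> T" "length \<rho>' = x" "prefix \<rho> \<rho>'" 
        using ext[OF tr(1,4)] ext[OF tr(2,5)] by blast
      moreover have "\<tau>' \<noteq> \<rho>'"
      proof
        assume "\<tau>' = \<rho>'"
        then have "prefix \<tau> \<rho> \<or> prefix \<rho> \<tau>" using ex prefix_same_cases by blast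
        then show False using tr(3-5) by (auto simp: prefix_def)
      qed
      ultimately show ?thesis using tr prefix_order.trans by metis
    qed
  qed
  then show ?thesis unfolding splits_def by blast
qed

section \<open>Monochromatic spreading and the trees it produces\<close>

text \<open>Membership of \<open>\<zeta>\<close> in a tree follows from closure under initial
  segments once \<open>\<tau>\<close> is in it.\<close>

definition sees :: "(bool list \<Rightarrow> nat) \<Rightarrow> nat \<Rightarrow> bool list \<Rightarrow> bool list \<Rightarrow> bool" where
  "sees C c \<sigma> \<tau> \<longleftrightarrow> (\<exists>\<zeta>. prefix \<sigma> \<zeta> \<and> prefix \<zeta> \<tau> \<and> C \<zeta> = c)"

lemma sees_prefix: "sees C c \<sigma> \<tau> \<Longrightarrow> prefix \<sigma> \<tau>"
  unfolding sees_def using prefix_order.trans by blast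

lemma sees_mono: "sees C c \<sigma> \<tau> \<Longrightarrow> prefix \<sigma>' \<sigma> \<Longrightarrow> prefix \<tau> \<tau>' \<Longrightarrow> sees C c \<sigma>' \<tau>'"
  unfolding sees_def using prefix_order.trans by metis

primrec spread :: "bool list set \<Rightarrow> (bool list \<Rightarrow> nat) \<Rightarrow> nat \<Rightarrow> bool list \<Rightarrow> nat list \<Rightarrow> bool" where
  "spread T C c \<sigma> [] \<longleftrightarrow> True"
| "spread T C c \<sigma> (y # ys) \<longleftrightarrow> (\<exists>\<tau>\<in>T. \<exists>\<rho>\<in>T. \<tau> \<noteq> \<rho> \<and>
     (\<forall>\<beta>\<in>{\<tau>, \<rho>}. length \<beta> = y \<and> sees C c \<sigma> \<beta> \<and> spread T C c \<beta> ys))"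

lemma spread_pull: "spread T C c \<sigma> (y # ys) \<Longrightarrow> prefix \<sigma>' \<sigma> \<Longrightarrow> spread T C c \<sigma>' (y # ys)"
  unfolding spread.simps by (meson sees_mono prefix_order.refl)

text \<open>Follow one branch through \<open>us\<close>, then pull its end back to
  \<open>\<sigma>\<close>; this only lengthens the segment on which the colour is seen.\<close>

lemma spread_drop: "spread T C c \<sigma> (us @ v # vs) \<Longrightarrow> spread T C c \<sigma> (v # vs)"
proof (induction us arbitrary: \<sigma>)
  case (Cons u us)
  then obtain \<tau> where "sees C c \<sigma> \<tau>" "spread T C c \<tau> (us @ v # vs)" by auto
  then show ?case using Cons.IH spread_pull sees_prefix by blast
qed simp

lemma spread_append1: "spread T C c \<sigma> (us @ vs) \<Longrightarrow> spread T C c \<sigma> us"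
proof (induction us arbitrary: \<sigma>)
  case (Cons u us)
  then show ?case unfolding append_Cons spread.simps by meson
qed simp

text \<open>Level \<open>b\<close> is replaced by the higher level \<open>s\<close>. The colour is
  already seen on the way to level \<open>b\<close>, so it is still seen after extending to level
  \<open>s\<close>, and distinct nodes of equal length have distinct extensions.\<close>

lemma spread_glue:
  assumes "spread T C c \<sigma> (us @ [b])"
    and "\<And>\<beta>. \<beta> \<in> T \<Longrightarrow> length \<beta> = b \<Longrightarrow> prefix \<sigma> \<beta> \<Longrightarrow>
      \<exists>\<rho>\<in>T. prefix \<beta> \<rho> \<and> length \<rho> = s \<and> spread T C c \<rho> vs"
  shows "spread T C c \<sigma> (us @ s # vs)"
  using assms
proof (induction us arbitrary: \<sigma>)
  case Nil
  then obtain \<tau> \<rho> where tr: "\<tau> \<in> T" "\<rho> \<in> T" "\<tau> \<noteq> \<rho>" "length \<tau> = b" "length \<rho> = b"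
    "sees C c \<sigma> \<tau>" "sees C c \<sigma> \<rho>" by auto
  obtain \<tau>' \<rho>' where ex: "\<tau>' \<in> T" "prefix \<tau> \<tau>'" "length \<tau>' = s" "spread T C c \<tau>' vs"
    "\<rho>' \<in> T" "prefix \<rho> \<rho>'" "length \<rho>' = s" "spread T C c \<rho>' vs"
    using Nil.prems(2)[OF tr(1,4) sees_prefix[OF tr(6)]] Nil.prems(2)[OF tr(2,5) sees_prefix[OF tr(7)]]
    by blast
  have "\<tau>' \<noteq> \<rho>'"
  proof
    assume "\<tau>' = \<rho>'"
    then have "prefix \<tau> \<rho> \<or> prefix \<rho> \<tau>" using ex prefix_same_cases by blast
    then show False using tr(3-5) by (auto simp: prefix_def)
  qed
  moreover have "sees C c \<sigma> \<tau>'" "sees C c \<sigma> \<rho>'"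
    using tr ex sees_mono prefix_order.refl by blast+
  ultimately show ?case using ex by auto
next
  case (Cons u us)
  then obtain \<tau> \<rho> where tr: "\<tau> \<in> T" "\<rho> \<in> T" "\<tau> \<noteq> \<rho>"
    "\<forall>\<beta>\<in>{\<tau>, \<rho>}. length \<beta> = u \<and> sees C c \<sigma> \<beta> \<and> spread T C c \<beta> (us @ [b])" by auto
  have "spread T C c \<beta> (us @ s # vs)" if "\<beta> \<in> {\<tau>, \<rho>}" for \<beta>
  proof (rule Cons.IH)
    show "spread T C c \<beta> (us @ [b])" using tr that by blast
    fix \<gamma> assume "\<gamma> \<in> T" "length \<gamma> = b" "prefix \<beta> \<gamma>"
    moreover have "prefix \<sigma> \<beta>" using tr that sees_prefix by blast
    ultimately show "\<exists>\<rho>\<in>T. prefix \<gamma> \<rho> \<and> length \<rho> = s \<and> spread T C c \<rho> vs"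
      using Cons.prems(2) prefix_order.trans by blast
  qed
  then show ?case using tr by auto
qed

lemma prefix_length_eq: "prefix \<sigma> \<tau> \<or> prefix \<tau> \<sigma> \<Longrightarrow> length \<sigma> = length \<tau> \<Longrightarrow> \<sigma> = \<tau>"
  by (auto simp: prefix_def)

text \<open>The tree is the union of the trees built above the two nodes at the first level.
  Comparability with the root makes the root the only node of its length, which keeps the two trees
  apart from level \<open>y\<close> on.\<close>

lemma spread_tree:
  assumes "is_tree T" "\<sigma> \<in> T" "sorted_wrt (<) (length \<sigma> # ys)" "spread T C c \<sigma> ys"
  shows "\<exists>S\<subseteq>T. finite S \<and> is_tree S \<and> \<sigma> \<in> S \<and> (\<forall>\<tau>\<in>S. prefix \<tau> \<sigma> \<or> prefix \<sigma> \<tau>) \<and>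
    (\<forall>x\<in>set (length \<sigma> # ys). \<exists>\<tau>\<in>S. length \<tau> = x) \<and>
    (\<forall>x x'. consec (set (length \<sigma> # ys)) x x' \<longrightarrow> (\<forall>\<tau>\<in>S. length \<tau> = x \<longrightarrow>
      card {\<rho>\<in>S. length \<rho> = x' \<and> prefix \<tau> \<rho>} = 2 \<and>
      (\<forall>\<rho>\<in>S. length \<rho> = x' \<longrightarrow> prefix \<tau> \<rho> \<longrightarrow> sees C c \<tau> \<rho>)))"
  using assms(2-)
proof (induction ys arbitrary: \<sigma>)
  case Nil
  have "finite {\<tau>. prefix \<tau> \<sigma>}"
    by (rule finite_subset[of _ "set (prefixes \<sigma>)"]) auto
  moreover have "is_tree {\<tau>. prefix \<tau> \<sigma>}"
    unfolding is_tree_def using prefix_order.trans by blast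
  moreover have "{\<tau>. prefix \<tau> \<sigma>} \<subseteq> T" using assms(1) Nil.prems(1) by (auto simp: is_tree_def)
  ultimately show ?case
    by (intro exI[of _ "{\<tau>. prefix \<tau> \<sigma>}"]) (auto simp: consec_def)
next
  case (Cons y ys)
  from Cons.prems(3) obtain \<alpha> \<beta> where ab: "\<alpha> \<in> T" "\<beta> \<in> T" "\<alpha> \<noteq> \<beta>" and
    R: "\<And>\<rho>. \<rho> \<in> {\<alpha>, \<beta>} \<Longrightarrow> length \<rho> = y \<and> sees C c \<sigma> \<rho> \<and> spread T C c \<rho> ys" by auto
  define R where "R = {\<alpha>, \<beta>}"
  have ly: "length \<sigma> < y" and srt: "sorted_wrt (<) (y # ys)" using Cons.prems(2) by auto
  have pre: "prefix \<sigma> \<rho>" if "\<rho> \<in> R" for \<rho> using R[of \<rho>] that sees_prefix by (auto simp: R_def)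
  have leny: "length \<rho> = y" if "\<rho> \<in> R" for \<rho> using R[of \<rho>] that by (simp add: R_def)
  let ?P = "\<lambda>\<rho> S. S \<subseteq> T \<and> finite S \<and> is_tree S \<and> \<rho> \<in> S \<and> (\<forall>\<tau>\<in>S. prefix \<tau> \<rho> \<or> prefix \<rho> \<tau>) \<and>
    (\<forall>x\<in>set (y # ys). \<exists>\<tau>\<in>S. length \<tau> = x) \<and>
    (\<forall>x x'. consec (set (y # ys)) x x' \<longrightarrow> (\<forall>\<tau>\<in>S. length \<tau> = x \<longrightarrow>
      card {\<rho>\<in>S. length \<rho> = x' \<and> prefix \<tau> \<rho>} = 2 \<and>
      (\<forall>\<rho>\<in>S. length \<rho> = x' \<longrightarrow> prefix \<tau> \<rho> \<longrightarrow> sees C c \<tau> \<rho>)))"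
  have "\<forall>\<rho>\<in>R. \<exists>S. ?P \<rho> S"
  proof
    fix \<rho> assume "\<rho> \<in> R"
    then have "\<rho> \<in> T" "length \<rho> = y" "spread T C c \<rho> ys" using ab R by (auto simp: R_def)
    with Cons.IH[of \<rho>] srt show "\<exists>S. ?P \<rho> S" by simp
  qed
  then obtain F where F: "\<forall>\<rho>\<in>R. ?P \<rho> (F \<rho>)" by (rule bchoice[THEN exE])
  have sub: "F \<rho> \<subseteq> T" and fin: "finite (F \<rho>)" and tr: "is_tree (F \<rho>)" and root: "\<rho> \<in> F \<rho>"
    and comp: "\<And>\<tau>. \<tau> \<in> F \<rho> \<Longrightarrow> prefix \<tau> \<rho> \<or> prefix \<rho> \<tau>"
    and lev: "\<And>x. x \<in> set (y # ys) \<Longrightarrow> \<exists>\<tau>\<in>F \<rho>. length \<tau> = x"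
    and con: "\<And>x x' \<tau>. consec (set (y # ys)) x x' \<Longrightarrow> \<tau> \<in> F \<rho> \<Longrightarrow> length \<tau> = x \<Longrightarrow>
      card {\<rho>'\<in>F \<rho>. length \<rho>' = x' \<and> prefix \<tau> \<rho>'} = 2 \<and>
      (\<forall>\<rho>'\<in>F \<rho>. length \<rho>' = x' \<longrightarrow> prefix \<tau> \<rho>' \<longrightarrow> sees C c \<tau> \<rho>')" if "\<rho> \<in> R" for \<rho>
    using bspec[OF F that] by blast+
  define S where "S = (\<Union>\<rho>\<in>R. F \<rho>)"
  have above: "prefix \<rho> \<tau>" if "\<rho> \<in> R" "\<tau> \<in> F \<rho>" "y \<le> length \<tau>" for \<rho> \<tau>
    using comp[OF that(1,2)] leny[OF that(1)] that(3)
    by (metis prefix_length_eq prefix_length_le le_antisym)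
  have comp\<sigma>: "prefix \<tau> \<sigma> \<or> prefix \<sigma> \<tau>" if \<tau>: "\<tau> \<in> S" for \<tau>
  proof -
    obtain \<rho> where \<rho>: "\<rho> \<in> R" "\<tau> \<in> F \<rho>" using \<tau> by (auto simp: S_def)
    from comp[OF \<rho>] show ?thesis
      using pre[OF \<rho>(1)] prefix_same_cases prefix_order.trans by blast
  qed
  have treeS: "is_tree S" using tr unfolding is_tree_def S_def by blast
  have "\<sigma> \<in> S" using root[of \<alpha>] pre[of \<alpha>] treeS unfolding is_tree_def S_def R_def by blast
  have at_y: "{\<rho>\<in>S. length \<rho> = y \<and> prefix \<sigma> \<rho>} = R"
  proof (intro equalityI subsetI)
    fix \<tau> assume "\<tau> \<in> {\<rho>\<in>S. length \<rho> = y \<and> prefix \<sigma> \<rho>}"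
    then obtain \<rho> where "\<rho> \<in> R" "\<tau> \<in> F \<rho>" "length \<tau> = y" by (auto simp: S_def)
    then show "\<tau> \<in> R" using comp leny prefix_length_eq by metis
  qed (use root leny pre in \<open>auto simp: S_def\<close>)
  have main: "card {\<rho>\<in>S. length \<rho> = x' \<and> prefix \<tau> \<rho>} = 2 \<and>
      (\<forall>\<rho>\<in>S. length \<rho> = x' \<longrightarrow> prefix \<tau> \<rho> \<longrightarrow> sees C c \<tau> \<rho>)"
    if c: "consec (set (length \<sigma> # y # ys)) x x'" and \<tau>: "\<tau> \<in> S" "length \<tau> = x" for x x' \<tau>
  proof (cases "x = length \<sigma>")
    case True
    have "\<tau> = \<sigma>" using comp\<sigma>[OF \<tau>(1)] \<tau>(2) True prefix_length_eq by blast
    have "y \<le> x'" using c srt True ly by (auto simp: consec_def)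
    moreover have "\<not> y < x'" using c True ly by (auto simp: consec_def)
    ultimately have "x' = y" by simp
    moreover have "sees C c \<sigma> \<rho>" if "\<rho> \<in> R" for \<rho> using R[of \<rho>] that by (simp add: R_def)
    moreover have "card R = 2" using ab(3) by (simp add: R_def)
    ultimately show ?thesis using at_y \<open>\<tau> = \<sigma>\<close> by auto
  next
    case False
    then have xin: "x \<in> set (y # ys)" using c by (auto simp: consec_def)
    then have yx: "y \<le> x" using srt by auto
    have c': "consec (set (y # ys)) x x'" using c xin yx ly by (auto simp: consec_def)
    obtain \<rho> where \<rho>: "\<rho> \<in> R" "\<tau> \<in> F \<rho>" using \<tau>(1) by (auto simp: S_def)
    \<comment> \<open>From level \<open>y\<close> on the trees are disjoint, so extensions of
      \<open>\<tau>\<close> can be counted within its own tree \<open>F \<rho>\<close>.\<close>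
    have in_F: "\<gamma> \<in> F \<rho>" if \<gamma>: "\<gamma> \<in> S" "prefix \<tau> \<gamma>" for \<gamma>
    proof -
      obtain \<rho>' where \<rho>': "\<rho>' \<in> R" "\<gamma> \<in> F \<rho>'" using \<gamma> by (auto simp: S_def)
      have "y \<le> length \<gamma>" using prefix_length_le[OF \<gamma>(2)] \<tau>(2) yx by simp
      then have "prefix \<rho>' \<gamma>" using above \<rho>' by blast
      moreover have "prefix \<rho> \<gamma>" using above[OF \<rho>] \<tau>(2) yx \<gamma>(2) prefix_order.trans by blast
      ultimately have "\<rho>' = \<rho>"
        using prefix_same_cases prefix_length_eq leny[OF \<rho>(1)] leny[OF \<rho>'(1)] by metis
      then show ?thesis using \<rho>' by simp
    qed
    have "F \<rho> \<subseteq> S" using \<rho>(1) by (auto simp: S_def)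
    then have "{\<gamma>\<in>S. length \<gamma> = x' \<and> prefix \<tau> \<gamma>} = {\<gamma>\<in>F \<rho>. length \<gamma> = x' \<and> prefix \<tau> \<gamma>}"
      using in_F by blast
    then show ?thesis using con[OF \<rho>(1) c' \<rho>(2) \<tau>(2)] in_F by auto
  qed
  have "\<forall>x\<in>set (length \<sigma> # y # ys). \<exists>\<tau>\<in>S. length \<tau> = x"
    using lev[of \<alpha>] \<open>\<sigma> \<in> S\<close> unfolding S_def R_def by (metis UN_I insertI1 set_ConsD)
  moreover have "S \<subseteq> T" "finite S" using sub fin by (auto simp: S_def R_def)
  ultimately show ?case
    using treeS \<open>\<sigma> \<in> S\<close> comp\<sigma> main by (intro exI[of _ S] conjI) blast+
qed

section \<open>Spreadable sequences and gluing\<close>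

text \<open>
  The last entry of \<open>ys\<close> does not belong to the large set. It ensures that the colour is also seen
  above the largest level of that set, which is needed to glue sequences.
\<close>

definition spreadable :: "bool list set \<Rightarrow> (bool list \<Rightarrow> nat) \<Rightarrow> nat \<Rightarrow> nat \<Rightarrow> nat set \<Rightarrow> nat list \<Rightarrow> bool" where
  "spreadable T C k d X ys \<longleftrightarrow>
     ys \<noteq> [] \<and> sorted_wrt (<) (Min X # ys) \<and> set ys \<subseteq> X \<and> olarge d (set (Min X # butlast ys)) \<and>
     (\<forall>\<sigma>\<in>T. length \<sigma> = Min X \<longrightarrow> (\<exists>c<k. spread T C c \<sigma> ys))"

text \<open>By \<open>spread_glue\<close> the extra last level of each list is exchanged for the
  start of the next one. The final list keeps its extra level, so the result again has the shape
  asked for in \<open>spreadable\<close>.\<close>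

fun glue :: "(nat \<Rightarrow> nat) \<Rightarrow> (nat \<Rightarrow> nat list) \<Rightarrow> nat list \<Rightarrow> nat list" where
  "glue s ys [] = []"
| "glue s ys [j] = s j # ys j"
| "glue s ys (j # i # js) = s j # butlast (ys j) @ glue s ys (i # js)"

lemma glue_Cons: "glue s ys (j # js) = s j # tl (glue s ys (j # js))"
  by (cases js) auto

text \<open>For largeness: what remains are the large parts of the pieces, and these form the
  required stack.\<close>

lemma butlast_glue:
  "\<forall>j\<in>set js. ys j \<noteq> [] \<Longrightarrow> butlast (glue s ys js) = concat (map (\<lambda>j. s j # butlast (ys j)) js)"
proof (induction s ys js rule: glue.induct)
  case (3 s ys j i js)
  have "glue s ys (i # js) \<noteq> []" by (subst glue_Cons) simp
  then show ?case using 3 by (simp add: butlast_append)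
qed auto

lemma set_glue: "set (glue s ys js) \<subseteq> (\<Union>j\<in>set js. insert (s j) (set (ys j)))"
  by (induction s ys js rule: glue.induct) (auto dest: in_set_butlastD)

lemma sorted_butlast: "sorted_wrt P xs \<Longrightarrow> sorted_wrt P (butlast xs)"
  by (metis append_butlast_last_id butlast.simps(1) sorted_wrt_append)

lemma sorted_glue:
  assumes "\<forall>j\<in>set js. sorted_wrt (<) (s j # ys j)"
    and "\<forall>j\<in>set js. \<forall>i\<in>set js. j < i \<longrightarrow> (\<forall>y\<in>set (s j # ys j). \<forall>z\<in>set (s i # ys i). y < z)"
    and "sorted_wrt (<) js"
  shows "sorted_wrt (<) (glue s ys js)"
  using assms
proof (induction s ys js rule: glue.induct)
  case (3 s ys j i js)
  have "sorted_wrt (<) (glue s ys (i # js))"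
  proof (rule 3(1))
    show "\<forall>j\<in>set (i # js). sorted_wrt (<) (s j # ys j)" using 3(2) by simp
    show "\<forall>j\<in>set (i # js). \<forall>l\<in>set (i # js). j < l \<longrightarrow>
        (\<forall>y\<in>set (s j # ys j). \<forall>z\<in>set (s l # ys l). y < z)"
      using 3(3) by (meson list.set_intros(2))
    show "sorted_wrt (<) (i # js)" using 3(4) by simp
  qed
  moreover have "sorted_wrt (<) (s j # butlast (ys j))"
    using 3(2) sorted_butlast by (auto dest: in_set_butlastD)
  moreover have "y < z" if y: "y \<in> set (s j # butlast (ys j))" and z: "z \<in> set (glue s ys (i # js))" for y z
  proof -
    obtain l where l: "l \<in> set (i # js)" "z \<in> insert (s l) (set (ys l))"
      using z set_glue[of s ys "i # js"] by blast
    have "y \<in> set (s j # ys j)" using y by (auto dest: in_set_butlastD)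
    moreover have "j < l" using l(1) 3(4) by auto
    moreover have "j \<in> set (j # i # js)" "l \<in> set (j # i # js)" "z \<in> set (s l # ys l)"
      using l by simp_all
    ultimately show ?thesis using 3(3) by blast
  qed
  ultimately show ?case by (auto simp: sorted_wrt_append)
qed auto

text \<open>Iterates \<open>spread_glue\<close>, with \<open>step\<close> as the jump from the end
  of one block to a later one. In the application \<open>\<rho>\<close> itself has length
  \<open>s j\<close>, hence the \<open>tl\<close>.\<close>

lemma spread_glue_list:
  assumes step: "\<And>j i \<beta>. j \<in> L \<Longrightarrow> i \<in> L \<Longrightarrow> j < i \<Longrightarrow> \<beta> \<in> T \<Longrightarrow> length \<beta> = last (ys j) \<Longrightarrow>
      prefix \<alpha> \<beta> \<Longrightarrow> \<exists>\<rho>\<in>T. prefix \<beta> \<rho> \<and> length \<rho> = s i \<and> spread T C c \<rho> (ys i)"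
    and ne: "\<And>j. j \<in> L \<Longrightarrow> ys j \<noteq> []"
    and "set (j # js) \<subseteq> L" "sorted_wrt (<) (j # js)" "prefix \<alpha> \<rho>" "spread T C c \<rho> (ys j)"
  shows "spread T C c \<rho> (tl (glue s ys (j # js)))"
  using assms(3-)
proof (induction js arbitrary: j \<rho>)
  case (Cons i js)
  have ji: "j \<in> L" "i \<in> L" "j < i" using Cons.prems by auto
  have "spread T C c \<rho> (butlast (ys j) @ s i # tl (glue s ys (i # js)))"
  proof (rule spread_glue[where b = "last (ys j)"])
    show "spread T C c \<rho> (butlast (ys j) @ [last (ys j)])" using Cons.prems(4) ne[OF ji(1)] by simp
    fix \<beta> assume \<beta>: "\<beta> \<in> T" "length \<beta> = last (ys j)" "prefix \<rho> \<beta>"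
    then have "prefix \<alpha> \<beta>" using Cons.prems(3) prefix_order.trans by blast
    then obtain \<gamma> where \<gamma>: "\<gamma> \<in> T" "prefix \<beta> \<gamma>" "length \<gamma> = s i" "spread T C c \<gamma> (ys i)"
      using step[OF ji \<beta>(1,2)] by blast
    moreover have "prefix \<alpha> \<gamma>" using \<open>prefix \<alpha> \<beta>\<close> \<gamma>(2) prefix_order.trans by blast
    ultimately show "\<exists>\<gamma>\<in>T. prefix \<beta> \<gamma> \<and> length \<gamma> = s i \<and> spread T C c \<gamma> (tl (glue s ys (i # js)))"
      using Cons.IH[of i \<gamma>] Cons.prems(1,2) by auto
  qed
  then show ?case using glue_Cons[of s ys i js] by simp
qed simp

section \<open>The induction on \<open>d\<close> and the conclusion\<close>

lemma card_level: "finite {\<sigma>\<in>T. length \<sigma> = n}" "card {\<sigma>\<in>T. length \<sigma> = n} \<le> 2 ^ n" for T :: "bool list set"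
proof -
  have *: "{\<sigma>\<in>T. length \<sigma> = n} \<subseteq> {\<sigma>. set \<sigma> \<subseteq> UNIV \<and> length \<sigma> = n}" by auto
  have fin: "finite {\<sigma>::bool list. set \<sigma> \<subseteq> UNIV \<and> length \<sigma> = n}" by (rule finite_lists_length_eq) simp
  then show "finite {\<sigma>\<in>T. length \<sigma> = n}" using * finite_subset by blast
  show "card {\<sigma>\<in>T. length \<sigma> = n} \<le> 2 ^ n"
    using card_mono[OF fin *] card_lists_length_eq[of "UNIV :: bool set" n] by simp
qed

lemma spreadable_Suc:
  assumes split: "splits X T" and X: "finite X" "X \<noteq> {}"
    and k: "k \<le> Min X" and x5: "5 \<le> Min X"
    and B: "blocks e X M B" and M: "2 ^ 2 ^ 2 ^ (2 * Min X) \<le> M"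
    and IH: "\<And>i. i < M \<Longrightarrow> \<exists>ys. spreadable T C k d (B i) ys"
  shows "\<exists>ys. spreadable T C k (Suc d) X ys"
proof -
  define x where "x = Min X"
  define s where "s i = Min (B i)" for i
  have "\<forall>i\<in>{..<M}. \<exists>ys. spreadable T C k d (B i) ys" using IH by simp
  then obtain ys where "\<forall>i\<in>{..<M}. spreadable T C k d (B i) (ys i)" by (rule bchoice[THEN exE])
  then have ys: "ys i \<noteq> []" "sorted_wrt (<) (s i # ys i)" "set (ys i) \<subseteq> B i"
    "olarge d (set (s i # butlast (ys i)))"
    and col: "\<And>\<rho>. \<rho> \<in> T \<Longrightarrow> length \<rho> = s i \<Longrightarrow> \<exists>c<k. spread T C c \<rho> (ys i)" if "i < M" for i
    using that unfolding spreadable_def s_def by blast+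
  have xX: "x \<in> X" using X by (simp add: x_def)
  have sX: "s i \<in> X" "x < s i" "s i \<in> B i" "B i \<subseteq> X" "finite (B i)" "B i \<noteq> {}" if "i < M" for i
    using blocksD[OF B that] unfolding s_def x_def by blast+
  have less: "y < z" if "j < i" "i < M" "y \<in> B j" "z \<in> B i" for i j y z
  proof -
    have "y \<le> Max (B j)" "Min (B i) \<le> z" using that sX[of j] sX[of i] by auto
    then show ?thesis using blocks_less[OF B that(1,2)] by simp
  qed
  have Bys: "set (s i # ys i) \<subseteq> B i" if "i < M" for i using sX(3) ys(3) that by auto
  define R where "R = {\<sigma>\<in>T. length \<sigma> = x}"
  \<comment> \<open>The number of pairs depends on \<open>x\<close> alone and not on the levels at
    which the blocks start.\<close>
  define P where "P = R \<times> {..<k}"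
  have finR: "finite R" and cR: "card R \<le> 2 ^ x" unfolding R_def by (rule card_level)+
  have finP: "finite P" using finR by (simp add: P_def)
  have "card P = k * card R" by (simp add: P_def card_cartesian_product)
  also have "\<dots> \<le> x * 2 ^ x" using k cR unfolding x_def[symmetric] by (intro mult_le_mono) simp_all
  finally have "live_bound (Suc x) (card P) \<le> 2 ^ 2 ^ 2 ^ (2 * x)"
    using live_bound_le_tower x5 by (simp add: x_def)
  then have bound: "live_bound (Suc x) (card P) \<le> card {..<M}" using M by (simp add: x_def)
  define le :: "(bool list \<Rightarrow> bool list) \<Rightarrow> (bool list \<Rightarrow> bool list) \<Rightarrow> bool"
    where "le \<phi> \<psi> \<longleftrightarrow> (\<forall>\<sigma>. prefix (\<phi> \<sigma>) (\<psi> \<sigma>))" for \<phi> \<psi>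
  \<comment> \<open>Lengths stay in \<open>X\<close> so that \<open>splits_extend\<close> can lift
    the chosen nodes to the start of a block.\<close>
  define low :: "nat \<Rightarrow> (bool list \<Rightarrow> bool list) \<Rightarrow> bool"
    where "low j \<phi> \<longleftrightarrow> (\<forall>\<sigma>\<in>R. \<phi> \<sigma> \<in> T \<and> length (\<phi> \<sigma>) \<in> X \<and> (\<forall>i<M. j \<le> i \<longrightarrow> length (\<phi> \<sigma>) \<le> s i))" for j \<phi>
  define free :: "(bool list \<Rightarrow> bool list) \<Rightarrow> bool list \<times> nat \<Rightarrow> nat \<Rightarrow> bool"
    where "free \<phi> p i \<longleftrightarrow> (\<forall>\<rho>\<in>T. length \<rho> = s i \<longrightarrow> prefix (\<phi> (fst p)) \<rho> \<longrightarrow> \<not> spread T C (snd p) \<rho> (ys i))" for \<phi> p i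
  interpret freeness le low free
  proof
    show "le u w" if "le u v" "le v w" for u v w
      using that unfolding le_def using prefix_order.trans by blast
    show "free w p i" if "free v p i" "le v w" for v w p i
      using that unfolding free_def le_def using prefix_order.trans by blast
  qed (auto simp: le_def low_def)
  have "low i (\<lambda>\<sigma>. \<sigma>)" for i
    using xX sX(2) less_imp_le by (auto simp: low_def R_def)
  then obtain \<phi> Q L where \<phi>: "le (\<lambda>\<sigma>. \<sigma>) \<phi>" and Q: "Q \<subseteq> P" and L: "L \<subseteq> {..<M}" "card L = Suc x"
    and ch: "chain Q \<phi> L" and dead: "\<forall>p\<in>P - Q. \<forall>i\<in>L. free \<phi> p i"
    using live_chain[OF finP finite_lessThan bound] by blast
  have LM: "i < M" if "i \<in> L" for i using L that by blast
  have finL: "finite L" using L(1) finite_subset by blast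
  \<comment> \<open>Of the \<open>Suc x\<close> blocks, \<open>j\<^sub>0\<close> determines the
    colour of each \<open>\<sigma>\<close>; the other \<open>x\<close> form the stack for
    \<open>d + 1\<close>.\<close>
  have "length (sorted_list_of_set L) = Suc x" using L(2) by simp
  then obtain j\<^sub>0 js where js: "sorted_list_of_set L = j\<^sub>0 # js" "length js = x"
    by (metis length_Suc_conv)
  then obtain j\<^sub>1 js' where js': "js = j\<^sub>1 # js'" using x5 by (cases js) (auto simp: x_def)
  have setL: "set (j\<^sub>0 # js) = L" using js(1) finL by (metis set_sorted_list_of_set)
  have srt: "sorted_wrt (<) (j\<^sub>0 # js)" using js(1) by (metis strict_sorted_list_of_set)
  have low\<phi>: "low i \<phi>" if "i \<in> L" for i using ch that by (auto simp: chain_def)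
  have jump: "\<exists>\<rho>\<in>T. prefix \<beta> \<rho> \<and> length \<rho> = s i \<and> spread T C c \<rho> (ys i)"
    if "(\<sigma>, c) \<in> Q" "j \<in> L" "i \<in> L" "j < i" "\<beta> \<in> T" "length \<beta> = last (ys j)" "prefix (\<phi> \<sigma>) \<beta>"
    for \<sigma> c i j \<beta>
  proof -
    have bB: "length \<beta> \<in> B j" using that(6) ys(1,3) LM[OF that(2)] last_in_set by fastforce
    \<comment> \<open>The move changes \<open>\<phi>\<close> at \<open>\<sigma>\<close> alone, to
      the node \<open>\<beta>\<close> at the end of block \<open>j\<close>. By the chain property
      the colour is still available in block \<open>i\<close> above \<open>\<beta>\<close>.\<close>
    have "low (Suc j) (\<phi>(\<sigma> := \<beta>))"
      unfolding low_def
    proof (intro ballI)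
      fix \<tau> assume \<tau>: "\<tau> \<in> R"
      show "(\<phi>(\<sigma> := \<beta>)) \<tau> \<in> T \<and> length ((\<phi>(\<sigma> := \<beta>)) \<tau>) \<in> X \<and>
          (\<forall>i<M. Suc j \<le> i \<longrightarrow> length ((\<phi>(\<sigma> := \<beta>)) \<tau>) \<le> s i)"
      proof (cases "\<tau> = \<sigma>")
        case True
        have "length \<beta> \<le> s i" if "i < M" "Suc j \<le> i" for i
          using less[of j i "length \<beta>" "s i"] bB sX(3) that by fastforce
        then show ?thesis using True that(5) bB sX(4)[OF LM[OF that(2)]] by auto
      next
        case False
        then show ?thesis using low\<phi>[OF that(2)] \<tau> by (auto simp: low_def)
      qed
    qed
    moreover have "le \<phi> (\<phi>(\<sigma> := \<beta>))" using that(7) by (simp add: le_def)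
    ultimately have "\<not> free (\<phi>(\<sigma> := \<beta>)) (\<sigma>, c) i"
      using ch that(1-4) unfolding chain_def by blast
    then show ?thesis by (auto simp: free_def)
  qed
  define zs where "zs = glue s ys js"
  have zs_Cons: "zs = s j\<^sub>1 # tl zs" unfolding zs_def js' by (rule glue_Cons)
  have jsL: "j \<in> L" if "j \<in> set js" for j using that setL by auto
  have zsB: "\<exists>j\<in>set js. z \<in> B j" if z: "z \<in> set zs" for z
  proof -
    obtain j where j: "j \<in> set js" "z \<in> set (s j # ys j)"
      using z set_glue[of s ys js] unfolding zs_def by auto
    then show ?thesis using Bys[OF LM[OF jsL[OF j(1)]]] by blast
  qed
  have bl: "butlast zs = concat (map (\<lambda>j. s j # butlast (ys j)) js)"
    unfolding zs_def using ys(1) jsL LM by (intro butlast_glue) blast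
  have "\<exists>c<k. spread T C c \<sigma> zs" if "\<sigma> \<in> R" for \<sigma>
  proof -
    have j0: "j\<^sub>0 \<in> L" using setL by auto
    have "\<phi> \<sigma> \<in> T" "length (\<phi> \<sigma>) \<in> X" "length (\<phi> \<sigma>) \<le> s j\<^sub>0"
      using low\<phi>[OF j0] that LM[OF j0] unfolding low_def by blast+
    then obtain \<rho> where \<rho>: "\<rho> \<in> T" "prefix (\<phi> \<sigma>) \<rho>" "length \<rho> = s j\<^sub>0"
      using splits_extend[OF split] sX(1)[OF LM[OF j0]] by blast
    then obtain c where c: "c < k" "spread T C c \<rho> (ys j\<^sub>0)" using col[OF LM[OF j0]] by blast
    then have "\<not> free \<phi> (\<sigma>, c) j\<^sub>0" using \<rho> by (auto simp: free_def)
    \<comment> \<open>A dropped pair would be free in block \<open>j\<^sub>0\<close>, but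
      \<open>\<rho>\<close> spreads there in colour \<open>c\<close>.\<close>
    then have inQ: "(\<sigma>, c) \<in> Q" using dead j0 that c(1) by (auto simp: P_def)
    have "spread T C c \<rho> (tl (glue s ys (j\<^sub>0 # js)))"
    proof (rule spread_glue_list[where L = L and \<alpha> = "\<phi> \<sigma>"])
      show "\<exists>\<rho>\<in>T. prefix \<beta> \<rho> \<and> length \<rho> = s i \<and> spread T C c \<rho> (ys i)"
        if "j \<in> L" "i \<in> L" "j < i" "\<beta> \<in> T" "length \<beta> = last (ys j)" "prefix (\<phi> \<sigma>) \<beta>" for j i \<beta>
        using jump[OF inQ that] .
      show "ys j \<noteq> []" if "j \<in> L" for j using ys(1)[OF LM[OF that]] .
      show "set (j\<^sub>0 # js) \<subseteq> L" using setL by simp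
    qed (fact srt \<rho>(2) c(2))+
    \<comment> \<open>The levels of block \<open>j\<^sub>0\<close> are discarded, and the root is
      pulled back from \<open>\<rho>\<close> to \<open>\<sigma>\<close>.\<close>
    then have "spread T C c \<rho> (butlast (ys j\<^sub>0) @ s j\<^sub>1 # tl zs)"
      using zs_Cons by (simp add: js' zs_def)
    then have "spread T C c \<rho> (s j\<^sub>1 # tl zs)" by (rule spread_drop)
    moreover have "prefix \<sigma> \<rho>" using \<phi> \<rho>(2) prefix_order.trans unfolding le_def by blast
    ultimately show ?thesis using c(1) zs_Cons spread_pull by metis
  qed
  moreover have "zs \<noteq> []" using zs_Cons by auto
  moreover have "set zs \<subseteq> X" using zsB sX(4) jsL LM by blast
  moreover have "sorted_wrt (<) (x # zs)"
  proof -
    have "sorted_wrt (<) zs"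
      unfolding zs_def
    proof (rule sorted_glue)
      show "\<forall>j\<in>set js. sorted_wrt (<) (s j # ys j)" using ys(2) jsL LM by blast
      show "\<forall>j\<in>set js. \<forall>i\<in>set js. j < i \<longrightarrow> (\<forall>y\<in>set (s j # ys j). \<forall>z\<in>set (s i # ys i). y < z)"
      proof (intro ballI impI)
        fix j i y z
        assume *: "j \<in> set js" "i \<in> set js" "j < i" "y \<in> set (s j # ys j)" "z \<in> set (s i # ys i)"
        then have "i < M" "j < M" using jsL LM by blast+
        then show "y < z" using less[OF *(3)] Bys *(4,5) by blast
      qed
      show "sorted_wrt (<) js" using srt by simp
    qed
    moreover have "x < z" if "z \<in> set zs" for z
    proof -
      obtain j where j: "j \<in> set js" "z \<in> B j" using zsB \<open>z \<in> set zs\<close> by blast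
      then have "s j \<le> z" using sX(5)[OF LM[OF jsL]] by (simp add: s_def)
      then show ?thesis using sX(2)[OF LM[OF jsL[OF j(1)]]] by simp
    qed
    ultimately show ?thesis by simp
  qed
  moreover have "olarge (Suc d) (set (x # butlast zs))"
  proof -
    define Y where "Y j = set (s j # butlast (ys j))" for j
    have YB: "Y j \<subseteq> B j" "Y j \<noteq> {}" "finite (Y j)" "olarge d (Y j)" if "j \<in> L" for j
      using Bys[OF LM[OF that]] ys(4)[OF LM[OF that]] by (auto simp: Y_def dest: in_set_butlastD)
    have above: "x < z" if "z \<in> set (butlast zs)" for z
      using \<open>sorted_wrt (<) (x # zs)\<close> that by (auto dest: in_set_butlastD)
    then have min: "Min (set (x # butlast zs)) = x" by (intro Min_eqI) (auto intro: less_imp_le)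
    have "set (x # butlast zs) - {x} = \<Union> (set (map Y js))"
      using above by (auto simp: bl Y_def)
    moreover have "Max (map Y js ! i) < Min (map Y js ! Suc i)" if "Suc i < x" for i
    proof -
      have i: "js ! i \<in> L" "js ! Suc i \<in> L" using that js(2) jsL by auto
      have "sorted_wrt (<) js" using srt by simp
      then have "js ! i < js ! Suc i" using that js(2) by (simp add: sorted_wrt_nth_less)
      then have "\<forall>y\<in>Y (js ! i). \<forall>z\<in>Y (js ! Suc i). y < z"
        using less[OF _ LM[OF i(2)]] YB(1)[OF i(1)] YB(1)[OF i(2)] by blast
      then show ?thesis using YB(2,3)[OF i(1)] YB(2,3)[OF i(2)] that js(2) by simp
    qed
    moreover have "\<forall>i<x. finite (map Y js ! i) \<and> map Y js ! i \<noteq> {} \<and> olarge d (map Y js ! i)"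
      using YB js(2) jsL by auto
    ultimately have "large_mult (olarge d) x (set (x # butlast zs) - {x})"
      unfolding large_mult_def using js(2) by (intro exI[of _ "map Y js"]) auto
    then show ?thesis unfolding olarge.simps min by simp
  qed
  ultimately have "spreadable T C k (Suc d) X zs"
    unfolding spreadable_def x_def[symmetric] R_def by blast
  then show ?thesis ..
qed

lemma spreadable_exists:
  assumes "olarge (2 * d + 1) X" "splits X T" "k \<le> Min X" "5 \<le> Min X" "\<forall>\<sigma>\<in>T. C \<sigma> < k"
  shows "\<exists>ys. spreadable T C k d X ys"
  using assms
proof (induction d arbitrary: X)
  case 0
  then have X: "finite X" "X \<noteq> {}" and large: "olarge (Suc 0) X" by auto
  obtain B where B: "blocks 0 X (Min X) B" using olarge_SucE[OF large] .
  define b where "b = Min (B 0)"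
  have "0 < Min X" using 0(4) by simp
  from blocksD[OF B this] have b: "b \<in> X" "Min X < b" unfolding b_def by blast+
  have "\<exists>c<k. spread T C c \<sigma> [b]" if \<sigma>: "\<sigma> \<in> T" "length \<sigma> = Min X" for \<sigma>
  proof -
    have "length \<sigma> \<in> X" "length \<sigma> < b" using X b \<sigma> by simp_all
    then obtain \<tau> \<rho> where "\<tau> \<in> T" "\<rho> \<in> T" "\<tau> \<noteq> \<rho>" "length \<tau> = b" "length \<rho> = b"
      "prefix \<sigma> \<tau>" "prefix \<sigma> \<rho>" using 0(2) b(1) \<sigma>(1) unfolding splits_def by blast
    \<comment> \<open>The colour is that of \<open>\<sigma>\<close> itself, so it is seen at
      once.\<close>
    then have "spread T C (C \<sigma>) \<sigma> [b]" by (auto simp: sees_def)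
    then show ?thesis using 0(5) \<sigma>(1) by blast
  qed
  then have "spreadable T C k 0 X [b]" using b by (simp add: spreadable_def)
  then show ?case ..
next
  case (Suc d)
  have "olarge (Suc (Suc (Suc (2 * d)))) X" using Suc.prems(1) by (simp only: mult_Suc_right add_Suc_right add_2_eq_Suc One_nat_def add_0_right)
  then obtain M B where MB: "2 ^ 2 ^ 2 ^ (2 * Min X) \<le> M" "blocks (Suc (2 * d)) X M B"
    using olarge_blocks[OF _ Suc.prems(4)] by blast
  have X: "finite X" "X \<noteq> {}" using Suc.prems(1) by auto
  show ?case
  proof (rule spreadable_Suc[OF Suc.prems(2) X Suc.prems(3,4) MB(2,1)])
    fix i assume i: "i < M"
    note Bi = blocksD[OF MB(2) i]
    have "olarge (2 * d + 1) (B i)" using Bi(5) by (simp only: Suc_eq_plus1)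
    moreover have "k \<le> Min (B i)" "5 \<le> Min (B i)" using Bi(4) Suc.prems(3,4) by simp_all
    ultimately show "\<exists>ys. spreadable T C k d (B i) ys"
      using Suc.IH splits_subset[OF Suc.prems(2) Bi(3)] Suc.prems(5) by blast
  qed
qed

theorem theorem2p3:
  fixes d k :: nat and X :: "nat set" and T :: "bool list set" and C :: "bool list \<Rightarrow> nat"
  assumes "olarge (2 * d + 1) X"
    and "Min X > max 4 k"
    and "quasistrong X T"
    and "\<forall>\<sigma>\<in>T. C \<sigma> < k"
  shows "\<exists>Y S. Y \<subseteq> X \<and> olarge d Y \<and> S \<subseteq> T \<and> quasistrong Y S \<and> prehomogeneous C Y S"
proof -
  have min: "k \<le> Min X" "5 \<le> Min X" using assms(2) by simp_all
  from spreadable_exists[OF assms(1) quasistrong_splits[OF assms(3)] min assms(4)]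
  obtain ys where ys: "ys \<noteq> []" "sorted_wrt (<) (Min X # ys)" "set ys \<subseteq> X"
    "olarge d (set (Min X # butlast ys))"
    "\<forall>\<sigma>\<in>T. length \<sigma> = Min X \<longrightarrow> (\<exists>c<k. spread T C c \<sigma> ys)"
    unfolding spreadable_def by blast
  have X: "finite X" "X \<noteq> {}" "is_tree T" using assms(3) by (auto simp: quasistrong_def)
  then have minX: "Min X \<in> X" by simp
  then obtain \<sigma> where \<sigma>: "\<sigma> \<in> T" "length \<sigma> = Min X"
    using assms(3) unfolding quasistrong_def by blast
  then obtain c where "spread T C c \<sigma> ys" using ys(5) by blast
  \<comment> \<open>Drops the extra level, which lies outside the large set.\<close>
  then have sp: "spread T C c \<sigma> (butlast ys)"
    using spread_append1[of T C c \<sigma> "butlast ys" "[last ys]"] ys(1) by simp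
  have srt: "sorted_wrt (<) (length \<sigma> # butlast ys)"
    using ys(2) \<sigma>(2) sorted_butlast[of "(<)" "Min X # ys"] ys(1) by simp
  define Y where "Y = set (length \<sigma> # butlast ys)"
  from spread_tree[OF X(3) \<sigma>(1) srt sp, folded Y_def] obtain S where S: "S \<subseteq> T" "finite S" "is_tree S"
    "\<forall>x\<in>Y. \<exists>\<tau>\<in>S. length \<tau> = x"
    "\<forall>x x'. consec Y x x' \<longrightarrow> (\<forall>\<tau>\<in>S. length \<tau> = x \<longrightarrow>
      card {\<rho>\<in>S. length \<rho> = x' \<and> prefix \<tau> \<rho>} = 2 \<and>
      (\<forall>\<rho>\<in>S. length \<rho> = x' \<longrightarrow> prefix \<tau> \<rho> \<longrightarrow> sees C c \<tau> \<rho>))" by blast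
  have "quasistrong Y S"
    using S unfolding quasistrong_def by (simp add: Y_def)
  moreover have "prehomogeneous C Y S"
    unfolding prehomogeneous_def
  proof (intro exI[of _ c] allI impI ballI)
    fix x x' \<tau> \<rho>
    assume "consec Y x x'" "\<tau> \<in> S" "\<rho> \<in> S" "length \<tau> = x" "length \<rho> = x'" "prefix \<tau> \<rho>"
    then have "sees C c \<tau> \<rho>" using S(5) by blast
    then show "\<exists>\<zeta>\<in>S. prefix \<tau> \<zeta> \<and> prefix \<zeta> \<rho> \<and> C \<zeta> = c"
      using S(3) \<open>\<rho> \<in> S\<close> unfolding sees_def is_tree_def by blast
  qed
  moreover have "Y \<subseteq> X" using minX ys(3) \<sigma>(2) by (auto simp: Y_def dest: in_set_butlastD)
  moreover have "olarge d Y" using ys(4) \<sigma>(2) by (simp add: Y_def)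
  ultimately show ?thesis using S(1) by blast
qed

end
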